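(* As $n\to\infty$ through odd integers $n\geq 3$, $$\mathrm{S}_{\mathrm{Dic}_{4n}}(3)\sim 6\,\mathrm{D}_{\mathrm{Dic}_{4n}}(3),\qquad \mathrm{S}_{\mathrm{Dic}_{4n}}(3)\sim 6\,\mathrm{B}_{\mathrm{Dic}_{4n}}(3),\qquad \mathrm{D}_{\mathrm{Dic}_{4n}}(3)\sim \mathrm{B}_{\mathrm{Dic}_{4n}}(3),$$ where $f(n)\sim g(n)$ means that $f(n)/g(n)\to 1$.
   Context: For a positive integer $n$, the dicyclic group is $\mathrm{Dic}_{4n}=\langle a,b : a^{2n}=1,\ a^{n}=b^2,\ b^{-1}ab=a^{-1}\rangle$, a group of order $4n$ with elements $1,a,\dots,a^{2n-1},b,ab,\dots,a^{2n-1}b$. For a subset $A$ of a finite (multiplicatively written) group, put $A+A=\{a_1a_2: a_1,a_2\in A\}$ and $A-A=\{a_1a_2^{-1}: a_1,a_2\in A\}$. The set $A$ is MSTD if $|A+A|>|A-A|$, balanced if $|A+A|=|A-A|$, and MDTS if $|A+A|<|A-A|$. For $k\in\mathbb{N}$, $\mathrm{S}_{\mathrm{Dic}_{4n}}(k)$, $\mathrm{D}_{\mathrm{Dic}_{4n}}(k)$, $\mathrm{B}_{\mathrm{Dic}_{4n}}(k)$ denote the numbers of MSTD, MDTS, and balanced subsets of $\mathrm{Dic}_{4n}$ of cardinality $k$, respectively. *)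

theory Defs
  imports Complex_Main "HOL-Algebra.Coset"
begin

text \<open>
  The pair (i, e) stands for a^i when e is False and for (a^i)b when e is True, with the exponent
  i reduced modulo 2n.  Since b a^j = a^(-j) b and b^2 = a^n, moving b past a^j negates j, and
  multiplying two elements outside the cyclic part contributes an additional n to the exponent.
  The lemmas below justify this model of the presentation for every positive n: it is a group of
  order 4n, its generators satisfy the relations, and it has the universal property of the
  presented group.
\<close>

definition Dic :: "nat \<Rightarrow> (int \<times> bool) monoid" where
  "Dic n = \<lparr>carrier = {0..<2 * int n} \<times> UNIV,
            mult = (\<lambda>(i, e) (j, f).
              ((i + (if e then - j else j) + (if e \<and> f then int n else 0)) mod (2 * int n), e \<noteq> f)),
            one = (0, False)\<rparr>"

abbreviation dic_a :: "int \<times> bool" where "dic_a \<equiv> (1, False)"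
abbreviation dic_b :: "int \<times> bool" where "dic_b \<equiv> (0, True)"

definition sumset :: "('a, 'm) monoid_scheme \<Rightarrow> 'a set \<Rightarrow> 'a set" where
  "sumset G A = {x \<otimes>\<^bsub>G\<^esub> y | x y. x \<in> A \<and> y \<in> A}"

definition diffset :: "('a, 'm) monoid_scheme \<Rightarrow> 'a set \<Rightarrow> 'a set" where
  "diffset G A = {x \<otimes>\<^bsub>G\<^esub> inv\<^bsub>G\<^esub> y | x y. x \<in> A \<and> y \<in> A}"

definition MSTD :: "('a, 'm) monoid_scheme \<Rightarrow> 'a set \<Rightarrow> bool" where
  "MSTD G A \<longleftrightarrow> card (sumset G A) > card (diffset G A)"

definition balanced :: "('a, 'm) monoid_scheme \<Rightarrow> 'a set \<Rightarrow> bool" where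
  "balanced G A \<longleftrightarrow> card (sumset G A) = card (diffset G A)"

definition MDTS :: "('a, 'm) monoid_scheme \<Rightarrow> 'a set \<Rightarrow> bool" where
  "MDTS G A \<longleftrightarrow> card (sumset G A) < card (diffset G A)"

definition num_MSTD :: "('a, 'm) monoid_scheme \<Rightarrow> nat \<Rightarrow> nat" where
  "num_MSTD G k = card {A. A \<subseteq> carrier G \<and> card A = k \<and> MSTD G A}"

definition num_MDTS :: "('a, 'm) monoid_scheme \<Rightarrow> nat \<Rightarrow> nat" where
  "num_MDTS G k = card {A. A \<subseteq> carrier G \<and> card A = k \<and> MDTS G A}"

definition num_balanced :: "('a, 'm) monoid_scheme \<Rightarrow> nat \<Rightarrow> nat" where
  "num_balanced G k = card {A. A \<subseteq> carrier G \<and> card A = k \<and> balanced G A}"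

lemma carrier_Dic: "carrier (Dic n) = {0..<2 * int n} \<times> UNIV"
  by (simp add: Dic_def)

lemma one_Dic: "\<one>\<^bsub>Dic n\<^esub> = (0, False)"
  by (simp add: Dic_def)

lemma mult_Dic:
  "(i, e) \<otimes>\<^bsub>Dic n\<^esub> (j, f) =
    ((i + (if e then - j else j) + (if e \<and> f then int n else 0)) mod (2 * int n), e \<noteq> f)"
  by (simp add: Dic_def)

lemma order_Dic: "order (Dic n) = 4 * n"
  by (simp add: order_def carrier_Dic card_cartesian_product)

lemma mod_diff_inner:
  "(u + v mod m - w) mod m = (u + v - w) mod m"
  "(v mod m - w + u) mod m = (v - w + u) mod m" for u v w m :: int
proof -
  have "(u + v mod m - w) mod m = ((u - w) + v mod m) mod m" by (simp add: algebra_simps)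
  also have "\<dots> = ((u - w) + v) mod m" by (rule mod_add_right_eq)
  also have "(u - w) + v = u + v - w" by simp
  finally show 1: "(u + v mod m - w) mod m = (u + v - w) mod m" .
  have "(v mod m - w + u) mod m = (u + v mod m - w) mod m" by (simp add: algebra_simps)
  then show "(v mod m - w + u) mod m = (v - w + u) mod m"
    by (simp add: 1 algebra_simps)
qed

lemma mult_Dic_assoc:
  "(x \<otimes>\<^bsub>Dic n\<^esub> y) \<otimes>\<^bsub>Dic n\<^esub> z = x \<otimes>\<^bsub>Dic n\<^esub> (y \<otimes>\<^bsub>Dic n\<^esub> z)"
proof -
  have shift: "u mod m = v mod m" if "u = v + m" for u v m :: int
    using that by simp
  obtain i e j f k g where "x = (i, e)" "y = (j, f)" "z = (k, g)"
    by (metis surj_pair)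
  then show ?thesis
    by (cases e; cases f; cases g)
       (auto simp: mult_Dic mod_simps mod_diff_inner algebra_simps intro: shift)
qed

lemma group_Dic:
  assumes "n > 0"
  shows "group (Dic n)"
proof (rule groupI)
  fix x assume x: "x \<in> carrier (Dic n)"
  then obtain i e where ie: "x = (i, e)" "0 \<le> i" "i < 2 * int n"
    by (auto simp: carrier_Dic)
  show "\<one>\<^bsub>Dic n\<^esub> \<otimes>\<^bsub>Dic n\<^esub> x = x"
    using ie by (simp add: one_Dic mult_Dic)
  show "\<exists>y\<in>carrier (Dic n). y \<otimes>\<^bsub>Dic n\<^esub> x = \<one>\<^bsub>Dic n\<^esub>"
  proof (rule bexI)
    let ?y = "((if e then i + int n else - i) mod (2 * int n), e)"
    show "?y \<otimes>\<^bsub>Dic n\<^esub> x = \<one>\<^bsub>Dic n\<^esub>"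
      using ie by (auto simp: one_Dic mult_Dic mod_simps mod_diff_inner)
    show "?y \<in> carrier (Dic n)"
      using assms by (simp add: carrier_Dic)
  qed
qed (use assms in \<open>auto simp: carrier_Dic one_Dic mult_Dic mult_Dic_assoc\<close>)

lemma dic_a_pow:
  assumes "n > 0"
  shows "dic_a [^]\<^bsub>Dic n\<^esub> k = (int k mod (2 * int n), False)"
proof -
  interpret group "Dic n" by (rule group_Dic[OF assms])
  show ?thesis
    by (induction k) (simp_all add: one_Dic mult_Dic mod_simps add.commute)
qed

lemma dic_relations:
  assumes "n > 0"
  shows "dic_a \<in> carrier (Dic n)" "dic_b \<in> carrier (Dic n)"
    and "dic_a [^]\<^bsub>Dic n\<^esub> (2 * n) = \<one>\<^bsub>Dic n\<^esub>"
    and "dic_a [^]\<^bsub>Dic n\<^esub> n = dic_b [^]\<^bsub>Dic n\<^esub> (2::nat)"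
    and "inv\<^bsub>Dic n\<^esub> dic_b \<otimes>\<^bsub>Dic n\<^esub> dic_a \<otimes>\<^bsub>Dic n\<^esub> dic_b = inv\<^bsub>Dic n\<^esub> dic_a"
proof -
  interpret group "Dic n" by (rule group_Dic[OF assms])
  show a: "dic_a \<in> carrier (Dic n)" and b: "dic_b \<in> carrier (Dic n)"
    using assms by (auto simp: carrier_Dic)
  show "dic_a [^]\<^bsub>Dic n\<^esub> (2 * n) = \<one>\<^bsub>Dic n\<^esub>"
    by (simp add: dic_a_pow[OF assms] one_Dic)
  show "dic_a [^]\<^bsub>Dic n\<^esub> n = dic_b [^]\<^bsub>Dic n\<^esub> (2::nat)"
    using assms by (simp add: dic_a_pow numeral_2_eq_2 one_Dic mult_Dic)
  have "dic_a \<otimes>\<^bsub>Dic n\<^esub> dic_b \<otimes>\<^bsub>Dic n\<^esub> dic_a = dic_b"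
    by (simp add: mult_Dic mod_simps)
  then have "dic_a \<otimes>\<^bsub>Dic n\<^esub> dic_b = dic_b \<otimes>\<^bsub>Dic n\<^esub> inv\<^bsub>Dic n\<^esub> dic_a"
    using a b by (metis inv_solve_right m_closed)
  then show "inv\<^bsub>Dic n\<^esub> dic_b \<otimes>\<^bsub>Dic n\<^esub> dic_a \<otimes>\<^bsub>Dic n\<^esub> dic_b = inv\<^bsub>Dic n\<^esub> dic_a"
    using a b by (simp add: m_assoc inv_solve_left')
qed

lemma dic_element:
  assumes "n > 0" "(i, e) \<in> carrier (Dic n)"
  shows "(i, e) = dic_a [^]\<^bsub>Dic n\<^esub> nat i \<otimes>\<^bsub>Dic n\<^esub> dic_b [^]\<^bsub>Dic n\<^esub> (if e then 1 else 0 :: nat)"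
proof -
  interpret group "Dic n" by (rule group_Dic[OF assms(1)])
  show ?thesis
    using assms by (auto simp: dic_a_pow carrier_Dic one_Dic mult_Dic simp del: pow_nat)
qed

lemma dic_universal:
  assumes n: "n > 0" and H: "group H" and x: "x \<in> carrier H" and y: "y \<in> carrier H"
    and rel1: "x [^]\<^bsub>H\<^esub> (2 * n) = \<one>\<^bsub>H\<^esub>"
    and rel2: "x [^]\<^bsub>H\<^esub> n = y [^]\<^bsub>H\<^esub> (2::nat)"
    and rel3: "inv\<^bsub>H\<^esub> y \<otimes>\<^bsub>H\<^esub> x \<otimes>\<^bsub>H\<^esub> y = inv\<^bsub>H\<^esub> x"
  shows "\<exists>h\<in>hom (Dic n) H. h dic_a = x \<and> h dic_b = y \<and>
    (\<forall>h'\<in>hom (Dic n) H. h' dic_a = x \<and> h' dic_b = y \<longrightarrow> (\<forall>z\<in>carrier (Dic n). h' z = h z))"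
proof -
  interpret H: group H by (rule H)
  interpret D: group "Dic n" by (rule group_Dic[OF n])
  define h where "h = (\<lambda>(i::int, e). x [^]\<^bsub>H\<^esub> i \<otimes>\<^bsub>H\<^esub> (if e then y else \<one>\<^bsub>H\<^esub>))"
  have per: "x [^]\<^bsub>H\<^esub> (i mod (2 * int n)) = x [^]\<^bsub>H\<^esub> i" for i :: int
  proof -
    have "x [^]\<^bsub>H\<^esub> (2 * int n) = \<one>\<^bsub>H\<^esub>"
      using rel1 int_pow_int[of H x "2 * n"] by simp
    then have "x [^]\<^bsub>H\<^esub> (2 * int n * (i div (2 * int n))) = \<one>\<^bsub>H\<^esub>"
      using x by (simp flip: H.int_pow_pow)
    then have "x [^]\<^bsub>H\<^esub> (2 * int n * (i div (2 * int n)) + i mod (2 * int n))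
        = x [^]\<^bsub>H\<^esub> (i mod (2 * int n))"
      using x by (simp only: H.int_pow_mult H.l_one H.int_pow_closed)
    then show ?thesis by simp
  qed
  have yy: "y \<otimes>\<^bsub>H\<^esub> y = x [^]\<^bsub>H\<^esub> int n"
    using rel2 y by (simp add: int_pow_int numeral_2_eq_2)
  have "x \<otimes>\<^bsub>H\<^esub> y = y \<otimes>\<^bsub>H\<^esub> inv\<^bsub>H\<^esub> x"
    using rel3 x y by (simp add: H.m_assoc H.inv_solve_left')
  then have yx: "y \<otimes>\<^bsub>H\<^esub> x = inv\<^bsub>H\<^esub> x \<otimes>\<^bsub>H\<^esub> y"
    using x y by (metis H.inv_closed H.inv_solve_left H.inv_solve_right H.m_assoc H.m_closed)
  have comm_nat: "y \<otimes>\<^bsub>H\<^esub> x [^]\<^bsub>H\<^esub> k = inv\<^bsub>H\<^esub> (x [^]\<^bsub>H\<^esub> k) \<otimes>\<^bsub>H\<^esub> y" for k :: nat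
  proof (induction k)
    case (Suc k)
    have "y \<otimes>\<^bsub>H\<^esub> x [^]\<^bsub>H\<^esub> Suc k = inv\<^bsub>H\<^esub> (x [^]\<^bsub>H\<^esub> k) \<otimes>\<^bsub>H\<^esub> (y \<otimes>\<^bsub>H\<^esub> x)"
      using Suc x y by (simp flip: H.m_assoc)
    also have "\<dots> = inv\<^bsub>H\<^esub> (x \<otimes>\<^bsub>H\<^esub> x [^]\<^bsub>H\<^esub> k) \<otimes>\<^bsub>H\<^esub> y"
      using x y by (simp add: yx H.inv_mult_group H.m_assoc)
    also have "x \<otimes>\<^bsub>H\<^esub> x [^]\<^bsub>H\<^esub> k = x [^]\<^bsub>H\<^esub> Suc k"
      using x by (simp only: H.nat_pow_Suc2)
    finally show ?case .
  qed (use x y in simp)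
  have comm: "y \<otimes>\<^bsub>H\<^esub> x [^]\<^bsub>H\<^esub> j = x [^]\<^bsub>H\<^esub> (- j) \<otimes>\<^bsub>H\<^esub> y" for j :: int
  proof -
    have "y \<otimes>\<^bsub>H\<^esub> x [^]\<^bsub>H\<^esub> (j mod (2 * int n)) = x [^]\<^bsub>H\<^esub> (- (j mod (2 * int n))) \<otimes>\<^bsub>H\<^esub> y"
      using comm_nat[of "nat (j mod (2 * int n))"] n x
      by (simp add: H.int_pow_neg flip: int_pow_int)
    moreover have "x [^]\<^bsub>H\<^esub> (- (j mod (2 * int n))) = x [^]\<^bsub>H\<^esub> (- j)"
      by (metis per mod_minus_eq)
    ultimately show ?thesis by (simp add: per)
  qed
  have hom: "h \<in> hom (Dic n) H"
  proof (rule homI)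
    fix u v assume "u \<in> carrier (Dic n)" "v \<in> carrier (Dic n)"
    obtain i e j f where uv: "u = (i, e)" "v = (j, f)" by (metis surj_pair)
    have left: "x [^]\<^bsub>H\<^esub> i \<otimes>\<^bsub>H\<^esub> y \<otimes>\<^bsub>H\<^esub> x [^]\<^bsub>H\<^esub> j = x [^]\<^bsub>H\<^esub> (i - j) \<otimes>\<^bsub>H\<^esub> y"
      using x y by (simp add: H.m_assoc comm flip: H.int_pow_mult)
        (simp add: H.int_pow_mult H.m_assoc diff_conv_add_uminus del: add_uminus_conv_diff)
    have both: "x [^]\<^bsub>H\<^esub> i \<otimes>\<^bsub>H\<^esub> y \<otimes>\<^bsub>H\<^esub> (x [^]\<^bsub>H\<^esub> j \<otimes>\<^bsub>H\<^esub> y) = x [^]\<^bsub>H\<^esub> (i - j + int n)"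
      using x y left by (simp add: H.m_assoc yy H.int_pow_mult flip: H.m_assoc)
        (simp add: H.m_assoc yy)
    show "h (u \<otimes>\<^bsub>Dic n\<^esub> v) = h u \<otimes>\<^bsub>H\<^esub> h v"
      using x y left both unfolding uv
      by (cases e; cases f) (simp_all add: h_def mult_Dic per H.int_pow_mult H.m_assoc)
  qed (use x y in \<open>auto simp: h_def\<close>)
  have val: "h dic_a = x" "h dic_b = y"
    using x y by (simp_all add: h_def)
  have uniq: "h' z = h z" if h': "h' \<in> hom (Dic n) H" "h' dic_a = x" "h' dic_b = y"
    and z: "z \<in> carrier (Dic n)" for h' z
  proof -
    obtain i e where ie: "z = (i, e)" by (metis surj_pair)
    have pow: "g (w [^]\<^bsub>Dic n\<^esub> k) = g w [^]\<^bsub>H\<^esub> k"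
      if "g \<in> hom (Dic n) H" "w \<in> carrier (Dic n)" for g w and k :: nat
    proof -
      interpret g: group_hom "Dic n" H g
        using that(1) by unfold_locales
      show ?thesis using that(2) by (rule g.hom_nat_pow)
    qed
    have "g z = x [^]\<^bsub>H\<^esub> nat i \<otimes>\<^bsub>H\<^esub> y [^]\<^bsub>H\<^esub> (if e then 1 else 0 :: nat)"
      if g: "g \<in> hom (Dic n) H" "g dic_a = x" "g dic_b = y" for g
    proof -
      note ab = dic_relations(1,2)[OF n]
      have "g z = g (dic_a [^]\<^bsub>Dic n\<^esub> nat i)
          \<otimes>\<^bsub>H\<^esub> g (dic_b [^]\<^bsub>Dic n\<^esub> (if e then 1 else 0 :: nat))"
        using dic_element[OF n z[unfolded ie]] ie ab
        by (metis hom_mult[OF g(1)] D.nat_pow_closed)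
      then show ?thesis
        by (simp only: pow[OF g(1)] ab g)
    qed
    from this[OF h'] this[OF hom val] show ?thesis by simp
  qed
  show ?thesis using hom val uniq by blast
qed

end

theory Submission
  imports Defs "HOL-Real_Asymp.Real_Asymp"
begin

text \<open>
  Call $a^i$ a rotation and $a^i b$ a reflection, and sort the three-element sets by their number of
  reflections.  Among the nine quotients of ordered pairs, the three on the diagonal collapse to
  the identity, so there are at most $7$.  For a triple of exponents in general position, the
  coincidences among the nine products are also determined by the number of reflections alone:

  \<^item> three rotations commute, so there are at most $6$ products, while all $7$ quotients occur
    (\<open>MDTS_rotations\<close>);
  \<^item> with one reflection the only coincidence is that the two rotations commute, which leaves $8$
    products, because $x r = r x^{-1}$ for a rotation $x$ and a reflection $r$
    (\<open>MSTD_one_reflection\<close>);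
  \<^item> with two reflections the only coincidence is that both have the square $a^n$, which again leaves
    $8$ products (\<open>MSTD_two_reflections\<close>);
  \<^item> a reflection $r$ has inverse $a^n r$ with $a^n$ central, so the quotient set of any set of
    reflections is a translate of its product set (\<open>balanced_reflections\<close>).

  A triple fails to be in general position only if it satisfies one of a fixed finite list of linear
  congruences modulo $2n$, which leaves $O(n^2)$ triples (\<open>card_nongeneric\<close>).  The four kinds
  contribute about $\frac43 n^3$, $4 n^3$, $4 n^3$, $\frac43 n^3$ sets, hence asymptotic lower bounds
  $8 n^3$, $\frac43 n^3$, $\frac43 n^3$ for the numbers of MSTD, MDTS and balanced sets.  These already
  add up to $\frac{32}3 n^3$, the leading term of the number $\binom{4n}3$ of all three-element sets, so
  each lower bound is attained asymptotically and no upper bounds need to be counted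
  (\<open>counts_limits\<close>).
\<close>

section \<open>Generic triples of exponents\<close>

text \<open>
  The exponents of all products and quotients of the elements considered are integer combinations of
  $i$, $j$, $k$ and $n$, read modulo $2n$.
\<close>

definition lin :: "nat \<Rightarrow> int \<times> int \<times> int \<Rightarrow> int \<times> int \<times> int \<times> int \<Rightarrow> int" where
  "lin n = (\<lambda>(i, j, k) (a, b, c, d). a * i + b * j + c * k + d * int n)"

text \<open>
  The bounds are chosen to contain all differences of two coefficient vectors of exponents
  occurring in one product or quotient set.  Only differences matter, since a coincidence of two
  exponents is a relation for the difference of their vectors.  A vector whose first three entries
  vanish expresses no condition on the triple and is excluded.
\<close>

definition relations :: "(int \<times> int \<times> int \<times> int) set" where
  "relations = {(a, b, c, d). a \<in> {-2..2} \<and> b \<in> {-2..2} \<and> c \<in> {-2..2} \<and> d \<in> {-1..1} \<and>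
     (a, b, c) \<noteq> (0, 0, 0)}"

definition exponent_triples :: "nat \<Rightarrow> (int \<times> int \<times> int) set" where
  "exponent_triples n = {0..<2 * int n} \<times> {0..<2 * int n} \<times> {0..<2 * int n}"

definition generic :: "nat \<Rightarrow> int \<times> int \<times> int \<Rightarrow> bool" where
  "generic n t \<longleftrightarrow> (\<forall>v\<in>relations. \<not> 2 * int n dvd lin n t v)"

lemma relations_finite: "finite relations" and card_relations: "card relations \<le> 375"
proof -
  let ?B = "{-2..2::int} \<times> {-2..2::int} \<times> {-2..2::int} \<times> {-1..1::int}"
  have sub: "relations \<subseteq> ?B" and fin: "finite ?B" by (auto simp: relations_def)
  show "finite relations" using sub fin by (rule finite_subset)
  have "card ?B = 375" by (simp add: card_cartesian_product)
  then show "card relations \<le> 375" using card_mono[OF fin sub] by simp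
qed

text \<open>
  When one exponent is solved for and the other two are fixed, the coefficient $\pm 1$ or $\pm 2$ can
  only be cancelled modulo $n$, not modulo $2n$.  The half of the interval $[0, 2n)$ that contains the
  solution restores uniqueness.
\<close>

lemma relation_solution_unique:
  fixes i i' a e :: int
  assumes "a \<in> {-2..2}" "a \<noteq> 0" "n > 0"
    and "2 * int n dvd a * i + e" "2 * int n dvd a * i' + e"
    and "i div int n = i' div int n"
  shows "i = i'"
proof -
  have "2 * int n dvd (a * i + e) - (a * i' + e)" using assms(4,5) by (rule dvd_diff)
  then have d: "2 * int n dvd a * (i - i')" by (simp add: algebra_simps)
  have "a = 1 \<or> a = -1 \<or> a = 2 \<or> a = -2" using assms(1,2) by auto
  moreover have "2 * int n dvd 2 * (i - i')" if "2 * int n dvd (i - i')"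
    using that by (rule dvd_mult)
  ultimately have "2 * int n dvd 2 * (i - i')"
    using d by (metis dvd_minus_iff minus_mult_left mult_1)
  then have "int n dvd i - i'" by (simp only: dvd_mult_cancel_left) simp
  then have "i mod int n = i' mod int n" by (simp add: mod_eq_dvd_iff)
  then show ?thesis using assms(6) by (metis mult_div_mod_eq)
qed

text \<open>
  Two of the exponents and one bit, the half containing the third exponent, determine a solution.
\<close>

lemma card_relation_solutions:
  assumes "v \<in> relations" and n: "n > 0"
  shows "card {t \<in> exponent_triples n. 2 * int n dvd lin n t v} \<le> 8 * n ^ 2" (is "card ?S \<le> _")
proof -
  obtain a b c d where v: "v = (a, b, c, d)" by (metis surj_pair)
  have r: "a \<in> {-2..2}" "b \<in> {-2..2}" "c \<in> {-2..2}" "(a, b, c) \<noteq> (0, 0, 0)"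
    using assms(1) by (auto simp: relations_def v)
  let ?I = "{0..<2 * int n}"
  have half: "i div int n = 1" if "0 \<le> i" "i < 2 * int n" "i div int n \<noteq> 0" for i
  proof -
    have "i div int n * int n + i mod int n = i" "i mod int n \<ge> 0" using n by simp_all
    moreover have "i < 2 * int n" using that by simp
    ultimately have "i div int n * int n < 2 * int n" by linarith
    then have "i div int n < 2" by (rule mult_right_less_imp_less) simp
    moreover have "i div int n \<ge> 0" using that n by (simp add: pos_imp_zdiv_nonneg_iff)
    ultimately show ?thesis using that by linarith
  qed
  have card: "card ({0, 1::int} \<times> ?I \<times> ?I) = 8 * n ^ 2"
    by (simp add: card_cartesian_product power2_eq_square nat_mult_distrib)
  have fin: "finite ({0, 1::int} \<times> ?I \<times> ?I)" by simp
  have bound: ?thesis if "inj_on f ?S" "f ` ?S \<subseteq> {0, 1::int} \<times> ?I \<times> ?I" for f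
    using card_inj_on_le[OF that fin] card by simp
  consider "a \<noteq> 0" | "b \<noteq> 0" | "c \<noteq> 0" using r(4) by auto
  then show ?thesis
  proof cases
    case 1
    let ?f = "\<lambda>(i, j, k). (i div int n, j, k)"
    show ?thesis
    proof (rule bound[of ?f])
      show "inj_on ?f ?S"
      proof (rule inj_onI)
        fix s t assume st: "s \<in> ?S" "t \<in> ?S" and eq: "?f s = ?f t"
        obtain i j k where s: "s = (i, j, k)" by (metis surj_pair)
        obtain i' where t: "t = (i', j, k)" and e: "i div int n = i' div int n"
          using eq s by (cases t) auto
        have "i = i'"
          using relation_solution_unique[OF r(1) 1 n _ _ e, of "b * j + c * k + d * int n"] st
          by (simp add: s t lin_def v algebra_simps)
        then show "s = t" by (simp add: s t)
      qed
      show "?f ` ?S \<subseteq> {0, 1} \<times> ?I \<times> ?I"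
        by (auto simp: exponent_triples_def intro: half)
    qed
  next
    case 2
    let ?f = "\<lambda>(i, j, k). (j div int n, i, k)"
    show ?thesis
    proof (rule bound[of ?f])
      show "inj_on ?f ?S"
      proof (rule inj_onI)
        fix s t assume st: "s \<in> ?S" "t \<in> ?S" and eq: "?f s = ?f t"
        obtain i j k where s: "s = (i, j, k)" by (metis surj_pair)
        obtain j' where t: "t = (i, j', k)" and e: "j div int n = j' div int n"
          using eq s by (cases t) auto
        have "j = j'"
          using relation_solution_unique[OF r(2) 2 n _ _ e, of "a * i + c * k + d * int n"] st
          by (simp add: s t lin_def v algebra_simps)
        then show "s = t" by (simp add: s t)
      qed
      show "?f ` ?S \<subseteq> {0, 1} \<times> ?I \<times> ?I"
        by (auto simp: exponent_triples_def intro: half)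
    qed
  next
    case 3
    let ?f = "\<lambda>(i, j, k). (k div int n, i, j)"
    show ?thesis
    proof (rule bound[of ?f])
      show "inj_on ?f ?S"
      proof (rule inj_onI)
        fix s t assume st: "s \<in> ?S" "t \<in> ?S" and eq: "?f s = ?f t"
        obtain i j k where s: "s = (i, j, k)" by (metis surj_pair)
        obtain k' where t: "t = (i, j, k')" and e: "k div int n = k' div int n"
          using eq s by (cases t) auto
        have "k = k'"
          using relation_solution_unique[OF r(3) 3 n _ _ e, of "a * i + b * j + d * int n"] st
          by (simp add: s t lin_def v algebra_simps)
        then show "s = t" by (simp add: s t)
      qed
      show "?f ` ?S \<subseteq> {0, 1} \<times> ?I \<times> ?I"
        by (auto simp: exponent_triples_def intro: half)
    qed
  qed
qed

lemma card_nongeneric: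
  assumes "n > 0"
  shows "card {t \<in> exponent_triples n. \<not> generic n t} \<le> 3000 * n ^ 2"
proof -
  let ?S = "\<lambda>v. {t \<in> exponent_triples n. 2 * int n dvd lin n t v}"
  have "{t \<in> exponent_triples n. \<not> generic n t} = (\<Union>v\<in>relations. ?S v)"
    by (auto simp: generic_def)
  then have "card {t \<in> exponent_triples n. \<not> generic n t} \<le> (\<Sum>v\<in>relations. card (?S v))"
    using card_UN_le[OF relations_finite, of ?S] by simp
  also have "\<dots> \<le> card relations * (8 * n ^ 2)"
    using sum_bounded_above[of relations "\<lambda>v. card (?S v)" "8 * n ^ 2"]
      card_relation_solutions[OF _ assms] by simp
  also have "\<dots> \<le> 375 * (8 * n ^ 2)" by (rule mult_right_mono[OF card_relations]) simp
  finally show ?thesis by simp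
qed

text \<open>
  Reduces the distinctness of exponents for generic triples to a computation with the
  concrete coefficient vectors.  The last entry is dropped in the second hypothesis because
  vectors which only differ in the multiple of $n$ are not separated by genericity.
\<close>

lemma generic_distinct_values:
  assumes "generic n t"
    and "distinct (map (\<lambda>(a, b, c, d). (a, b, c)) vs)"
    and "\<forall>(a, b, c, d)\<in>set vs. \<forall>(a', b', c', d')\<in>set vs.
      a - a' \<in> {-2..2} \<and> b - b' \<in> {-2..2} \<and> c - c' \<in> {-2..2} \<and> d - d' \<in> {-1..1}"
  shows "distinct (map (\<lambda>v. lin n t v mod (2 * int n)) vs)"
proof -
  have inj: "inj_on (\<lambda>(a, b, c, d). (a, b, c)) (set vs)" and "distinct vs"
    using assms(2) by (simp_all add: distinct_map)
  moreover have "inj_on (\<lambda>v. lin n t v mod (2 * int n)) (set vs)"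
  proof (rule inj_onI)
    fix v w assume vw: "v \<in> set vs" "w \<in> set vs"
      and eq: "lin n t v mod (2 * int n) = lin n t w mod (2 * int n)"
    obtain a b c d where v: "v = (a, b, c, d)" by (metis surj_pair)
    obtain a' b' c' d' where w: "w = (a', b', c', d')" by (metis surj_pair)
    have "lin n t v - lin n t w = lin n t (a - a', b - b', c - c', d - d')"
      by (simp add: lin_def v w algebra_simps split: prod.splits)
    then have "2 * int n dvd lin n t (a - a', b - b', c - c', d - d')"
      using eq by (simp add: mod_eq_dvd_iff)
    then have "(a - a', b - b', c - c', d - d') \<notin> relations"
      using assms(1) by (auto simp: generic_def)
    moreover have "a - a' \<in> {-2..2} \<and> b - b' \<in> {-2..2} \<and> c - c' \<in> {-2..2} \<and> d - d' \<in> {-1..1}"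
      using assms(3) vw unfolding v w by fastforce
    ultimately have "(a, b, c) = (a', b', c')"
      by (auto simp: relations_def)
    then show "v = w" using inj vw by (auto simp: v w inj_on_def)
  qed
  ultimately show ?thesis by (simp add: distinct_map)
qed

section \<open>Sum and difference sets of three-element sets\<close>

lemma sumset_triple:
  "sumset G {x, y, z} = {x \<otimes>\<^bsub>G\<^esub> x, x \<otimes>\<^bsub>G\<^esub> y, x \<otimes>\<^bsub>G\<^esub> z, y \<otimes>\<^bsub>G\<^esub> x, y \<otimes>\<^bsub>G\<^esub> y, y \<otimes>\<^bsub>G\<^esub> z,
     z \<otimes>\<^bsub>G\<^esub> x, z \<otimes>\<^bsub>G\<^esub> y, z \<otimes>\<^bsub>G\<^esub> z}"
  by (auto simp: sumset_def)

lemma diffset_triple: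
  "diffset G {x, y, z} = {x \<otimes>\<^bsub>G\<^esub> inv\<^bsub>G\<^esub> x, x \<otimes>\<^bsub>G\<^esub> inv\<^bsub>G\<^esub> y, x \<otimes>\<^bsub>G\<^esub> inv\<^bsub>G\<^esub> z,
     y \<otimes>\<^bsub>G\<^esub> inv\<^bsub>G\<^esub> x, y \<otimes>\<^bsub>G\<^esub> inv\<^bsub>G\<^esub> y, y \<otimes>\<^bsub>G\<^esub> inv\<^bsub>G\<^esub> z,
     z \<otimes>\<^bsub>G\<^esub> inv\<^bsub>G\<^esub> x, z \<otimes>\<^bsub>G\<^esub> inv\<^bsub>G\<^esub> y, z \<otimes>\<^bsub>G\<^esub> inv\<^bsub>G\<^esub> z}"
  by (auto simp: diffset_def)

lemma inv_Dic:
  assumes "n > 0" "i \<in> {0..<2 * int n}"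
  shows "inv\<^bsub>Dic n\<^esub> (i, e) = ((if e then i + int n else - i) mod (2 * int n), e)"
proof -
  interpret group "Dic n" by (rule group_Dic[OF assms(1)])
  show ?thesis
  proof (rule inv_equality)
    show "((if e then i + int n else - i) mod (2 * int n), e) \<otimes>\<^bsub>Dic n\<^esub> (i, e) = \<one>\<^bsub>Dic n\<^esub>"
      by (auto simp: one_Dic mult_Dic mod_simps mod_diff_inner)
  qed (use assms in \<open>auto simp: carrier_Dic\<close>)
qed

lemma diff_Dic:
  assumes "n > 0" "j \<in> {0..<2 * int n}"
  shows "(i, e) \<otimes>\<^bsub>Dic n\<^esub> inv\<^bsub>Dic n\<^esub> (j, f) =
    ((if e = f then i - j else if e then i + j else i + j + int n) mod (2 * int n), e \<noteq> f)"
proof -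
  let ?m = "2 * int n"
  have 1: "(i - (j + int n) mod ?m + int n) mod ?m = (i - j) mod ?m"
    by (metis (no_types, lifting) add_diff_cancel_right diff_add_eq mod_add_left_eq mod_diff_right_eq)
  have 2: "(i - (- j) mod ?m) mod ?m = (i + j) mod ?m"
    by (simp add: mod_diff_right_eq)
  have 3: "(i + (- j) mod ?m) mod ?m = (i - j) mod ?m"
    by (simp add: mod_add_right_eq)
  have 4: "(i + (j + int n) mod ?m) mod ?m = (i + j + int n) mod ?m"
    by (simp add: mod_add_right_eq add.assoc)
  show ?thesis
    using 1 2 3 4 by (simp add: inv_Dic[OF assms] mult_Dic)
qed

lemma card_le_length: "A \<subseteq> set xs \<Longrightarrow> card A \<le> length xs"
  by (meson card_length card_mono finite_set le_trans)

lemma length_le_card: "distinct xs \<Longrightarrow> set xs \<subseteq> A \<Longrightarrow> finite A \<Longrightarrow> length xs \<le> card A"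
  by (metis card_mono distinct_card)

lemma distinct_tagged_append:
  assumes "distinct xs" "distinct ys"
  shows "distinct (map (\<lambda>x. (x, False)) xs @ map (\<lambda>x. (x, True)) ys)"
  using assms by (auto simp: distinct_map inj_on_def)

text \<open>
  Commutativity leaves $6$ products, and coincidences among the $7$ quotients are relations on the
  triple.
\<close>

lemma MDTS_rotations:
  assumes n: "n > 0" and I: "(i, j, k) \<in> exponent_triples n" and g: "generic n (i, j, k)"
  shows "MDTS (Dic n) {(i, False), (j, False), (k, False)}"
proof -
  let ?A = "{(i, False), (j, False), (k, False)}"
  let ?m = "2 * int n"
  have "sumset (Dic n) ?A \<subseteq> set [((i+i) mod ?m, False), ((i+j) mod ?m, False), ((i+k) mod ?m, False),
      ((j+j) mod ?m, False), ((j+k) mod ?m, False), ((k+k) mod ?m, False)]"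
    by (auto simp: sumset_triple mult_Dic add.commute)
  from card_le_length[OF this] have s: "card (sumset (Dic n) ?A) \<le> 6" by simp
  let ?vs = "[(0,0,0,0), (1,-1,0,0), (1,0,-1,0), (-1,1,0,0), (0,1,-1,0), (-1,0,1,0), (0,-1,1,0)]
    :: (int \<times> int \<times> int \<times> int) list"
  let ?xs = "map (\<lambda>v. lin n (i, j, k) v mod ?m) ?vs"
  have "distinct ?xs" by (rule generic_distinct_values[OF g]) simp_all
  then have d: "distinct (map (\<lambda>x. (x, False)) ?xs @ map (\<lambda>x. (x, True)) [])"
    by (rule distinct_tagged_append) simp
  have I': "i \<in> {0..<?m}" "j \<in> {0..<?m}" "k \<in> {0..<?m}" using I by (auto simp: exponent_triples_def)
  have "set (map (\<lambda>x. (x, False)) ?xs @ map (\<lambda>x. (x, True)) []) \<subseteq> diffset (Dic n) ?A"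
    by (simp add: diffset_triple diff_Dic[OF n I'(1)] diff_Dic[OF n I'(2)] diff_Dic[OF n I'(3)] lin_def)
  from length_le_card[OF d this] have "card (diffset (Dic n) ?A) \<ge> 7"
    by (simp add: diffset_triple)
  with s show ?thesis by (simp add: MDTS_def)
qed

text \<open>
  The list \<open>?vs\<close> holds the exponents of the rotations among the products, including $a^n$ as the
  square of the reflection, and \<open>?ws\<close> those of the reflections.
\<close>

lemma MSTD_one_reflection:
  assumes n: "n > 0" and I: "(i, j, k) \<in> exponent_triples n" and g: "generic n (i, j, k)"
  shows "MSTD (Dic n) {(i, False), (j, False), (k, True)}"
proof -
  let ?A = "{(i, False), (j, False), (k, True)}"
  let ?m = "2 * int n"
  have I': "i \<in> {0..<?m}" "j \<in> {0..<?m}" "k \<in> {0..<?m}" using I by (auto simp: exponent_triples_def)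
  have "diffset (Dic n) ?A \<subseteq> set [(0, False), ((i-j) mod ?m, False), ((j-i) mod ?m, False),
      ((i+k+int n) mod ?m, True), ((j+k+int n) mod ?m, True), ((k+i) mod ?m, True), ((k+j) mod ?m, True)]"
    by (simp add: diffset_triple diff_Dic[OF n I'(1)] diff_Dic[OF n I'(2)] diff_Dic[OF n I'(3)])
  from card_le_length[OF this] have s: "card (diffset (Dic n) ?A) \<le> 7" by simp
  let ?vs = "[(2,0,0,0), (1,1,0,0), (0,2,0,0), (0,0,0,1)] :: (int \<times> int \<times> int \<times> int) list"
  let ?ws = "[(1,0,1,0), (0,1,1,0), (-1,0,1,0), (0,-1,1,0)] :: (int \<times> int \<times> int \<times> int) list"
  let ?xs = "map (\<lambda>v. lin n (i, j, k) v mod ?m) ?vs"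
  let ?ys = "map (\<lambda>v. lin n (i, j, k) v mod ?m) ?ws"
  have "distinct ?xs" by (rule generic_distinct_values[OF g]) simp_all
  moreover have "distinct ?ys" by (rule generic_distinct_values[OF g]) simp_all
  ultimately have d: "distinct (map (\<lambda>x. (x, False)) ?xs @ map (\<lambda>x. (x, True)) ?ys)"
    by (rule distinct_tagged_append)
  have "set (map (\<lambda>x. (x, False)) ?xs @ map (\<lambda>x. (x, True)) ?ys) \<subseteq> sumset (Dic n) ?A"
    by (simp add: sumset_triple mult_Dic lin_def)
  from length_le_card[OF d this] have "card (sumset (Dic n) ?A) \<ge> 8"
    by (simp add: sumset_triple)
  with s show ?thesis by (simp add: MSTD_def)
qed

text \<open>
  Among the rotations, \<open>?vs\<close>, the exponent $n$ stands for both squares of reflections, and the products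
  of the two different reflections contribute $n \pm (j - k)$.
\<close>

lemma MSTD_two_reflections:
  assumes n: "n > 0" and I: "(i, j, k) \<in> exponent_triples n" and g: "generic n (i, j, k)"
  shows "MSTD (Dic n) {(i, False), (j, True), (k, True)}"
proof -
  let ?A = "{(i, False), (j, True), (k, True)}"
  let ?m = "2 * int n"
  have I': "i \<in> {0..<?m}" "j \<in> {0..<?m}" "k \<in> {0..<?m}" using I by (auto simp: exponent_triples_def)
  have "diffset (Dic n) ?A \<subseteq> set [(0, False), ((j-k) mod ?m, False), ((k-j) mod ?m, False),
      ((i+j+int n) mod ?m, True), ((i+k+int n) mod ?m, True), ((j+i) mod ?m, True), ((k+i) mod ?m, True)]"
    by (simp add: diffset_triple diff_Dic[OF n I'(1)] diff_Dic[OF n I'(2)] diff_Dic[OF n I'(3)])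
  from card_le_length[OF this] have s: "card (diffset (Dic n) ?A) \<le> 7" by simp
  let ?vs = "[(2,0,0,0), (0,0,0,1), (0,1,-1,1), (0,-1,1,1)] :: (int \<times> int \<times> int \<times> int) list"
  let ?ws = "[(1,1,0,0), (1,0,1,0), (-1,1,0,0), (-1,0,1,0)] :: (int \<times> int \<times> int \<times> int) list"
  let ?xs = "map (\<lambda>v. lin n (i, j, k) v mod ?m) ?vs"
  let ?ys = "map (\<lambda>v. lin n (i, j, k) v mod ?m) ?ws"
  have "distinct ?xs" by (rule generic_distinct_values[OF g]) simp_all
  moreover have "distinct ?ys" by (rule generic_distinct_values[OF g]) simp_all
  ultimately have d: "distinct (map (\<lambda>x. (x, False)) ?xs @ map (\<lambda>x. (x, True)) ?ys)"
    by (rule distinct_tagged_append)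
  have "set (map (\<lambda>x. (x, False)) ?xs @ map (\<lambda>x. (x, True)) ?ys) \<subseteq> sumset (Dic n) ?A"
    by (simp add: sumset_triple mult_Dic lin_def)
  from length_le_card[OF d this] have "card (sumset (Dic n) ?A) \<ge> 8"
    by (simp add: sumset_triple)
  with s show ?thesis by (simp add: MSTD_def)
qed

text \<open>
  The inverse of a reflection is the reflection multiplied by the central element $a^n$, so
  translation by $a^n$ maps the quotient set bijectively onto the product set.
\<close>

lemma balanced_reflections:
  assumes n: "n > 0" and Y: "Y \<subseteq> {0..<2 * int n}"
  shows "balanced (Dic n) (Y \<times> {True})"
proof -
  let ?m = "2 * int n"
  let ?shift = "\<lambda>(x, e). ((x + int n) mod ?m, e)"
  have mult: "(i, True) \<otimes>\<^bsub>Dic n\<^esub> (j, True) = ((i - j + int n) mod ?m, False)" for i j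
    by (simp add: mult_Dic)
  have diff: "(i, True) \<otimes>\<^bsub>Dic n\<^esub> inv\<^bsub>Dic n\<^esub> (j, True) = ((i - j) mod ?m, False)" if "j \<in> Y" for i j
    using diff_Dic[OF n, of j i True True] that Y by auto
  have s: "sumset (Dic n) (Y \<times> {True}) = (\<lambda>(i, j). ((i - j + int n) mod ?m, False)) ` (Y \<times> Y)"
  proof (intro equalityI subsetI)
    fix z assume "z \<in> sumset (Dic n) (Y \<times> {True})"
    then obtain i j where "i \<in> Y" "j \<in> Y" "z = (i, True) \<otimes>\<^bsub>Dic n\<^esub> (j, True)"
      unfolding sumset_def by blast
    then show "z \<in> (\<lambda>(i, j). ((i - j + int n) mod ?m, False)) ` (Y \<times> Y)"
      unfolding mult by (intro image_eqI[of _ _ "(i, j)"]) auto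
  next
    fix z assume "z \<in> (\<lambda>(i, j). ((i - j + int n) mod ?m, False)) ` (Y \<times> Y)"
    then obtain i j where ij: "i \<in> Y" "j \<in> Y" "z = ((i - j + int n) mod ?m, False)" by auto
    then have "z = (i, True) \<otimes>\<^bsub>Dic n\<^esub> (j, True)" by (simp only: mult)
    then show "z \<in> sumset (Dic n) (Y \<times> {True})" unfolding sumset_def using ij by blast
  qed
  have d: "diffset (Dic n) (Y \<times> {True}) = (\<lambda>(i, j). ((i - j) mod ?m, False)) ` (Y \<times> Y)"
  proof (intro equalityI subsetI)
    fix z assume "z \<in> diffset (Dic n) (Y \<times> {True})"
    then obtain i j where ij: "i \<in> Y" "j \<in> Y" "z = (i, True) \<otimes>\<^bsub>Dic n\<^esub> inv\<^bsub>Dic n\<^esub> (j, True)"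
      unfolding diffset_def by blast
    then show "z \<in> (\<lambda>(i, j). ((i - j) mod ?m, False)) ` (Y \<times> Y)"
      unfolding diff[OF ij(2)] by (intro image_eqI[of _ _ "(i, j)"]) auto
  next
    fix z assume "z \<in> (\<lambda>(i, j). ((i - j) mod ?m, False)) ` (Y \<times> Y)"
    then obtain i j where ij: "i \<in> Y" "j \<in> Y" "z = ((i - j) mod ?m, False)" by auto
    then have "z = (i, True) \<otimes>\<^bsub>Dic n\<^esub> inv\<^bsub>Dic n\<^esub> (j, True)" by (simp only: diff)
    then show "z \<in> diffset (Dic n) (Y \<times> {True})" unfolding diffset_def using ij by blast
  qed
  have "sumset (Dic n) (Y \<times> {True}) = ?shift ` diffset (Dic n) (Y \<times> {True})"
    unfolding s d image_image by (rule image_cong) (auto simp: mod_add_left_eq)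
  moreover have "inj_on ?shift (diffset (Dic n) (Y \<times> {True}))"
  proof (rule inj_onI)
    fix p q assume pq: "p \<in> diffset (Dic n) (Y \<times> {True})" "q \<in> diffset (Dic n) (Y \<times> {True})"
      and eq: "?shift p = ?shift q"
    obtain x y where xy: "p = (x mod ?m, False)" "q = (y mod ?m, False)" using pq d by auto
    with eq have "(x + int n) mod ?m = (y + int n) mod ?m" by (simp add: mod_add_left_eq)
    then show "p = q" unfolding xy by (simp add: mod_eq_dvd_iff)
  qed
  ultimately show ?thesis by (simp add: balanced_def card_image)
qed

section \<open>Counting by the number of reflections\<close>

text \<open>
  Given as an image of pairs of exponent sets, since this map is injective and so reduces
  counting to binomial coefficients.
\<close>

definition family :: "nat \<Rightarrow> nat \<Rightarrow> nat \<Rightarrow> (int \<times> bool) set set" where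
  "family n p q = (\<lambda>(X, Y). X \<times> {False} \<union> Y \<times> {True}) `
     ({X. X \<subseteq> {0..<2 * int n} \<and> card X = p} \<times> {Y. Y \<subseteq> {0..<2 * int n} \<and> card Y = q})"

lemma tagged_union_inject:
  "X \<times> {False} \<union> Y \<times> {True} = X' \<times> {False} \<union> Y' \<times> {True} \<longleftrightarrow> X = X' \<and> Y = Y'"
  by blast

lemma card_family: "card (family n p q) = (2 * n choose p) * (2 * n choose q)"
proof -
  let ?f = "\<lambda>(X :: int set, Y). X \<times> {False} \<union> Y \<times> {True}"
  have "inj ?f"
  proof (rule injI)
    fix P Q assume "?f P = ?f Q"
    then show "P = Q" by (cases P, cases Q) (simp only: tagged_union_inject prod.case prod.inject)
  qed
  then have "card (family n p q) =
      card ({X. X \<subseteq> {0..<2 * int n} \<and> card X = p} \<times> {Y. Y \<subseteq> {0..<2 * int n} \<and> card Y = q})"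
    unfolding family_def by (rule card_image[OF inj_on_subset[OF _ subset_UNIV]])
  then show ?thesis by (simp add: card_cartesian_product n_subsets nat_mult_distrib)
qed

lemma family_subset: "family n p q \<subseteq> {A. A \<subseteq> carrier (Dic n) \<and> card A = p + q}"
proof -
  have "card (X \<times> {False} \<union> Y \<times> {True}) = card X + card Y"
    if "X \<subseteq> {0..<2 * int n}" "Y \<subseteq> {0..<2 * int n}" for X Y
    using that by (subst card_Un_disjoint) (auto simp: card_cartesian_product intro: finite_subset)
  then show ?thesis by (auto simp: family_def carrier_Dic)
qed

lemma finite_carrier_subsets: "finite {A. A \<subseteq> carrier (Dic n) \<and> P A}"
  by (rule finite_subset[of _ "Pow (carrier (Dic n))"]) (auto simp: carrier_Dic)

lemma finite_family: "finite (family n p q)"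
  using family_subset finite_carrier_subsets by (rule finite_subset)

text \<open>
  If all members of a family are listed by triples through \<open>h\<close>, not necessarily injectively, then
  the members without the property lie in the image of the nongeneric triples.
\<close>

lemma card_generic_members:
  assumes n: "n > 0"
    and members: "\<And>A. A \<in> family n p q \<Longrightarrow> \<exists>t\<in>exponent_triples n. A = h t"
    and P: "\<And>t. t \<in> exponent_triples n \<Longrightarrow> generic n t \<Longrightarrow> P (h t)"
  shows "(2 * n choose p) * (2 * n choose q) \<le> card {A \<in> family n p q. P A} + 3000 * n ^ 2"
proof -
  let ?C = "family n p q" and ?N = "{t \<in> exponent_triples n. \<not> generic n t}"
  have finN: "finite ?N" by (simp add: exponent_triples_def)
  have "?C \<subseteq> {A \<in> ?C. P A} \<union> h ` ?N" using members P by blast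
  then have "card ?C \<le> card ({A \<in> ?C. P A} \<union> h ` ?N)"
    using finite_family finN by (intro card_mono) auto
  also have "\<dots> \<le> card {A \<in> ?C. P A} + card (h ` ?N)" by (rule card_Un_le)
  also have "card (h ` ?N) \<le> card ?N" using finN by (rule card_image_le)
  finally show ?thesis using card_nongeneric[OF n] by (simp add: card_family)
qed

lemma familyE:
  assumes "A \<in> family n p q"
  obtains X Y where "X \<subseteq> {0..<2 * int n}" "Y \<subseteq> {0..<2 * int n}" "card X = p" "card Y = q"
    "A = X \<times> {False} \<union> Y \<times> {True}"
  using assms unfolding family_def by blast

lemma num_MDTS_lower:
  assumes n: "n > 0"
  shows "(2 * n choose 3) \<le> num_MDTS (Dic n) 3 + 3000 * n ^ 2"
proof -
  let ?h = "\<lambda>(i, j, k). {(i, False), (j, False), (k, False)}"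
  have "(2 * n choose 3) * (2 * n choose 0) \<le> card {A \<in> family n 3 0. MDTS (Dic n) A} + 3000 * n ^ 2"
  proof (rule card_generic_members[OF n, where h = ?h])
    fix A assume "A \<in> family n 3 0"
    then obtain X Y where XY: "X \<subseteq> {0..<2 * int n}" "Y \<subseteq> {0..<2 * int n}" "card X = 3" "card Y = 0"
      "A = X \<times> {False} \<union> Y \<times> {True}"
      by (rule familyE)
    then have "Y = {}" using finite_subset[OF XY(2)] by simp
    obtain i j k where "X = {i, j, k}" using XY(3) by (auto simp: card_3_iff)
    then show "\<exists>t\<in>exponent_triples n. A = ?h t"
      using XY \<open>Y = {}\<close> by (intro bexI[of _ "(i, j, k)"]) (auto simp: exponent_triples_def)
  next
    fix t assume "t \<in> exponent_triples n" "generic n t"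
    then show "MDTS (Dic n) (?h t)" by (cases t) (simp add: MDTS_rotations[OF n])
  qed
  moreover have "card {A \<in> family n 3 0. MDTS (Dic n) A} \<le> num_MDTS (Dic n) 3"
    unfolding num_MDTS_def using family_subset[of n 3 0]
    by (intro card_mono finite_carrier_subsets) auto
  ultimately show ?thesis by simp
qed

lemma num_balanced_lower:
  assumes n: "n > 0"
  shows "(2 * n choose 3) \<le> num_balanced (Dic n) 3"
proof -
  have "balanced (Dic n) A" if A: "A \<in> family n 0 3" for A
  proof -
    obtain X Y where XY: "X \<subseteq> {0..<2 * int n}" "Y \<subseteq> {0..<2 * int n}" "card X = 0" "card Y = 3"
      "A = X \<times> {False} \<union> Y \<times> {True}"
      using A by (rule familyE)
    then have "X = {}" using finite_subset[OF XY(1)] by simp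
    then show ?thesis using balanced_reflections[OF n XY(2)] XY(5) by simp
  qed
  then have "card (family n 0 3) \<le> num_balanced (Dic n) 3"
    unfolding num_balanced_def using family_subset[of n 0 3]
    by (intro card_mono finite_carrier_subsets) auto
  then show ?thesis by (simp add: card_family)
qed

lemma num_MSTD_lower:
  assumes n: "n > 0"
  shows "4 * n * (2 * n choose 2) \<le> num_MSTD (Dic n) 3 + 6000 * n ^ 2"
proof -
  let ?h = "\<lambda>(i, j, k). {(i, False), (j, False), (k, True)}"
  have 1: "(2 * n choose 2) * (2 * n choose 1) \<le> card {A \<in> family n 2 1. MSTD (Dic n) A} + 3000 * n ^ 2"
  proof (rule card_generic_members[OF n, where h = ?h])
    fix A assume "A \<in> family n 2 1"
    then obtain X Y where XY: "X \<subseteq> {0..<2 * int n}" "Y \<subseteq> {0..<2 * int n}" "card X = 2" "card Y = 1"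
      "A = X \<times> {False} \<union> Y \<times> {True}"
      by (rule familyE)
    obtain i j where "X = {i, j}" using XY(3) by (auto simp: card_2_iff)
    moreover obtain k where "Y = {k}" using XY(4) by (auto simp: card_1_singleton_iff)
    ultimately show "\<exists>t\<in>exponent_triples n. A = ?h t"
      using XY by (intro bexI[of _ "(i, j, k)"]) (auto simp: exponent_triples_def)
  next
    fix t assume "t \<in> exponent_triples n" "generic n t"
    then show "MSTD (Dic n) (?h t)" by (cases t) (simp add: MSTD_one_reflection[OF n])
  qed
  let ?h' = "\<lambda>(i, j, k). {(i, False), (j, True), (k, True)}"
  have 2: "(2 * n choose 1) * (2 * n choose 2) \<le> card {A \<in> family n 1 2. MSTD (Dic n) A} + 3000 * n ^ 2"
  proof (rule card_generic_members[OF n, where h = ?h'])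
    fix A assume "A \<in> family n 1 2"
    then obtain X Y where XY: "X \<subseteq> {0..<2 * int n}" "Y \<subseteq> {0..<2 * int n}" "card X = 1" "card Y = 2"
      "A = X \<times> {False} \<union> Y \<times> {True}"
      by (rule familyE)
    obtain j k where "Y = {j, k}" using XY(4) by (auto simp: card_2_iff)
    moreover obtain i where "X = {i}" using XY(3) by (auto simp: card_1_singleton_iff)
    ultimately show "\<exists>t\<in>exponent_triples n. A = ?h' t"
      using XY by (intro bexI[of _ "(i, j, k)"]) (auto simp: exponent_triples_def)
  next
    fix t assume "t \<in> exponent_triples n" "generic n t"
    then show "MSTD (Dic n) (?h' t)" by (cases t) (simp add: MSTD_two_reflections[OF n])
  qed
  let ?M = "{A \<in> family n 2 1. MSTD (Dic n) A}" and ?M' = "{A \<in> family n 1 2. MSTD (Dic n) A}"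
  have "A \<notin> family n 1 2" if A: "A \<in> family n 2 1" for A
  proof
    assume "A \<in> family n 1 2"
    then obtain X Y where 1: "card X = 1" "A = X \<times> {False} \<union> Y \<times> {True}" by (rule familyE)
    obtain X' Y' where 2: "card X' = 2" "A = X' \<times> {False} \<union> Y' \<times> {True}" using A by (rule familyE)
    have "X = X'" using 1(2) 2(2) tagged_union_inject[of X Y X' Y'] by simp
    with 1(1) 2(1) show False by simp
  qed
  then have "?M \<inter> ?M' = {}" by blast
  then have "card ?M + card ?M' = card (?M \<union> ?M')" by (simp add: card_Un_disjoint finite_family)
  also have "\<dots> \<le> num_MSTD (Dic n) 3"
    unfolding num_MSTD_def using family_subset[of n 2 1] family_subset[of n 1 2]
    by (intro card_mono finite_carrier_subsets) auto
  finally have "card ?M + card ?M' \<le> num_MSTD (Dic n) 3" .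
  moreover have "4 * n * (2 * n choose 2) =
      (2 * n choose 2) * (2 * n choose 1) + (2 * n choose 1) * (2 * n choose 2)"
    by (simp only: choose_one) simp
  ultimately show ?thesis using 1 2 by linarith
qed

lemma num_total:
  "num_MSTD (Dic n) k + num_MDTS (Dic n) k + num_balanced (Dic n) k = 4 * n choose k"
proof -
  let ?T = "\<lambda>P. {A. A \<subseteq> carrier (Dic n) \<and> card A = k \<and> P (Dic n) A}"
  have fin: "finite (?T P)" for P by (rule finite_carrier_subsets)
  have disj: "?T MSTD \<inter> ?T MDTS = {}" "(?T MSTD \<union> ?T MDTS) \<inter> ?T balanced = {}"
    by (auto simp: MSTD_def MDTS_def balanced_def)
  have "{A. A \<subseteq> carrier (Dic n) \<and> card A = k} = (?T MSTD \<union> ?T MDTS) \<union> ?T balanced"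
    by (auto simp: MSTD_def MDTS_def balanced_def)
  then have "card {A. A \<subseteq> carrier (Dic n) \<and> card A = k} =
      num_MSTD (Dic n) k + num_MDTS (Dic n) k + num_balanced (Dic n) k"
    unfolding num_MSTD_def num_MDTS_def num_balanced_def
    by (simp only: card_Un_disjoint[OF finite_UnI[OF fin[of MSTD] fin[of MDTS]] fin[of balanced] disj(2)]
        card_Un_disjoint[OF fin[of MSTD] fin[of MDTS] disj(1)])
  moreover have "finite (carrier (Dic n))" by (simp add: carrier_Dic)
  then have "card {A. A \<subseteq> carrier (Dic n) \<and> card A = k} = 4 * n choose k"
    using n_subsets[of "carrier (Dic n)" k] order_Dic[of n] by (simp only: order_def)
  ultimately show ?thesis by simp
qed

section \<open>Limits\<close>

lemma real_choose_2: "real (m choose 2) = real m * (real m - 1) / 2"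
  by (induction m) (simp_all add: numeral_2_eq_2 field_simps)

lemma real_choose_3: "real (m choose 3) = real m * (real m - 1) * (real m - 2) / 6"
proof (induction m)
  case (Suc m)
  have "real (Suc m choose 3) = real (m choose 2) + real (m choose 3)"
    by (simp add: numeral_3_eq_3 numeral_2_eq_2)
  then show ?case unfolding Suc.IH real_choose_2 by (simp add: field_simps)
qed simp

text \<open>
  Each lower bound, subtracted from the total, bounds the other counts from above; as the leading
  terms $8 + \frac43 + \frac43 = \frac{32}3$ are exhausted, both bounds for each count have the same
  limit.
\<close>

lemma counts_limits:
  "(\<lambda>n. real (num_MSTD (Dic n) 3) / real n ^ 3) \<longlonglongrightarrow> 8" (is "?S \<longlonglongrightarrow> _")
  "(\<lambda>n. real (num_MDTS (Dic n) 3) / real n ^ 3) \<longlonglongrightarrow> 4 / 3" (is "?D \<longlonglongrightarrow> _")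
  "(\<lambda>n. real (num_balanced (Dic n) 3) / real n ^ 3) \<longlonglongrightarrow> 4 / 3" (is "?B \<longlonglongrightarrow> _")
proof -
  \<comment> \<open>lower bounds for the three counts and their exact total, all scaled by $n^{-3}$\<close>
  define c where "c n = 2 * real n * (2 * real n - 1) * (2 * real n - 2) / 6" for n
  define s where "s n = (4 * real n * (2 * real n * (2 * real n - 1) / 2) - 6000 * real n ^ 2) / real n ^ 3" for n
  define d where "d n = (c n - 3000 * real n ^ 2) / real n ^ 3" for n
  define b where "b n = c n / real n ^ 3" for n
  define t where "t n = 4 * real n * (4 * real n - 1) * (4 * real n - 2) / 6 / real n ^ 3" for n
  have lims: "s \<longlonglongrightarrow> 8" "d \<longlonglongrightarrow> 4 / 3" "b \<longlonglongrightarrow> 4 / 3" "t \<longlonglongrightarrow> 32 / 3"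
    unfolding s_def d_def b_def t_def c_def by (real_asymp, real_asymp, real_asymp, real_asymp)
  have tot: "?S n + ?D n + ?B n = t n" for n
  proof -
    have "real (num_MSTD (Dic n) 3 + num_MDTS (Dic n) 3 + num_balanced (Dic n) 3)
        = 4 * real n * (4 * real n - 1) * (4 * real n - 2) / 6"
      unfolding num_total real_choose_3 by simp
    then show ?thesis by (simp only: t_def of_nat_add flip: add_divide_distrib)
  qed
  have lower: "s n \<le> ?S n" "d n \<le> ?D n" "b n \<le> ?B n" if "n > 0" for n
  proof -
    have "real (4 * n * (2 * n choose 2)) \<le> real (num_MSTD (Dic n) 3 + 6000 * n ^ 2)"
      using num_MSTD_lower[OF that] by (simp only: of_nat_le_iff)
    then show "s n \<le> ?S n"
      unfolding s_def by (intro divide_right_mono) (simp_all add: real_choose_2)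
    have "real (2 * n choose 3) \<le> real (num_MDTS (Dic n) 3 + 3000 * n ^ 2)"
      using num_MDTS_lower[OF that] by (simp only: of_nat_le_iff)
    then show "d n \<le> ?D n"
      unfolding d_def c_def by (intro divide_right_mono) (simp_all add: real_choose_3)
    have "real (2 * n choose 3) \<le> real (num_balanced (Dic n) 3)"
      using num_balanced_lower[OF that] by (simp only: of_nat_le_iff)
    then show "b n \<le> ?B n"
      unfolding b_def c_def by (intro divide_right_mono) (simp_all add: real_choose_3)
  qed
  have ev: "eventually (\<lambda>n. s n \<le> ?S n \<and> d n \<le> ?D n \<and> b n \<le> ?B n) sequentially"
    using eventually_gt_at_top[of 0] by eventually_elim (use lower in blast)
  show "?S \<longlonglongrightarrow> 8"
  proof (rule tendsto_sandwich)
    show "eventually (\<lambda>n. s n \<le> ?S n) sequentially"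
      using ev by eventually_elim simp
    show "eventually (\<lambda>n. ?S n \<le> t n - d n - b n) sequentially"
      using ev
    proof eventually_elim
      case (elim n)
      then show ?case using tot[of n] by linarith
    qed
    show "s \<longlonglongrightarrow> 8" by (fact lims)
    show "(\<lambda>n. t n - d n - b n) \<longlonglongrightarrow> 8"
      using tendsto_diff[OF tendsto_diff[OF lims(4) lims(2)] lims(3)] by simp
  qed
  show "?D \<longlonglongrightarrow> 4 / 3"
  proof (rule tendsto_sandwich)
    show "eventually (\<lambda>n. d n \<le> ?D n) sequentially"
      using ev by eventually_elim simp
    show "eventually (\<lambda>n. ?D n \<le> t n - s n - b n) sequentially"
      using ev
    proof eventually_elim
      case (elim n)
      then show ?case using tot[of n] by linarith
    qed
    show "d \<longlonglongrightarrow> 4 / 3" by (fact lims)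
    show "(\<lambda>n. t n - s n - b n) \<longlonglongrightarrow> 4 / 3"
      using tendsto_diff[OF tendsto_diff[OF lims(4) lims(1)] lims(3)] by simp
  qed
  show "?B \<longlonglongrightarrow> 4 / 3"
  proof (rule tendsto_sandwich)
    show "eventually (\<lambda>n. b n \<le> ?B n) sequentially"
      using ev by eventually_elim simp
    show "eventually (\<lambda>n. ?B n \<le> t n - s n - d n) sequentially"
      using ev
    proof eventually_elim
      case (elim n)
      then show ?case using tot[of n] by linarith
    qed
    show "b \<longlonglongrightarrow> 4 / 3" by (fact lims)
    show "(\<lambda>n. t n - s n - d n) \<longlonglongrightarrow> 4 / 3"
      using tendsto_diff[OF tendsto_diff[OF lims(4) lims(1)] lims(2)] by simp
  qed
qed

theorem mainTheorem4:
  fixes S D B :: "nat \<Rightarrow> real" and F :: "nat filter"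
  defines "S \<equiv> \<lambda>n. real (num_MSTD (Dic n) 3)"
    and "D \<equiv> \<lambda>n. real (num_MDTS (Dic n) 3)"
    and "B \<equiv> \<lambda>n. real (num_balanced (Dic n) 3)"
    and "F \<equiv> inf at_top (principal {n. odd n \<and> n \<ge> 3})"
  shows "((\<lambda>n. S n / (6 * D n)) \<longlongrightarrow> 1) F \<and>
    ((\<lambda>n. S n / (6 * B n)) \<longlongrightarrow> 1) F \<and>
    ((\<lambda>n. D n / B n) \<longlongrightarrow> 1) F"
proof -
  have F: "F \<le> sequentially" unfolding F_def by simp
  have lims: "(\<lambda>n. S n / real n ^ 3) \<longlonglongrightarrow> 8"
    "(\<lambda>n. D n / real n ^ 3) \<longlonglongrightarrow> 4 / 3" "(\<lambda>n. B n / real n ^ 3) \<longlonglongrightarrow> 4 / 3"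
    unfolding S_def D_def B_def by (fact counts_limits)+
  have ratio: "(\<lambda>n. f n / (c * g n)) \<longlonglongrightarrow> x / (c * y)"
    if "(\<lambda>n. f n / real n ^ 3) \<longlonglongrightarrow> x" "(\<lambda>n. g n / real n ^ 3) \<longlonglongrightarrow> y" "c \<noteq> 0" "y \<noteq> 0"
    for f g :: "nat \<Rightarrow> real" and c x y
  proof -
    have "(\<lambda>n. (f n / real n ^ 3) / (c * (g n / real n ^ 3))) \<longlonglongrightarrow> x / (c * y)"
      using that by (intro tendsto_intros) auto
    moreover have "eventually (\<lambda>n. (f n / real n ^ 3) / (c * (g n / real n ^ 3)) = f n / (c * g n)) sequentially"
      using eventually_gt_at_top[of 0] by eventually_elim simp
    ultimately show ?thesis by (rule Lim_transform_eventually)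
  qed
  have "(\<lambda>n. S n / (6 * D n)) \<longlonglongrightarrow> 1" "(\<lambda>n. S n / (6 * B n)) \<longlonglongrightarrow> 1" "(\<lambda>n. D n / B n) \<longlonglongrightarrow> 1"
    using ratio[OF lims(1,2), of 6] ratio[OF lims(1,3), of 6] ratio[OF lims(2,3), of 1] by simp_all
  then show ?thesis using tendsto_mono[OF F] by blast
qed

end
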